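(* Let $n\ge 1$, $\lambda=(\lambda_1,\dots,\lambda_n)\in\mathbb{R}^n$, $\mu\in\mathbb{R}$ and $\delta=\mu-\sum_{i=1}^n\lambda_i$. If $\delta=k\in\mathbb{N}$, then $$\dim \mathrm{H}^1_{\mathrm{diff}}(\mathfrak{aff}(1);\mathrm{D}_{\lambda,\mu})=\binom{n+k-1}{k}.$$
   Context: $\mathbb{N}=\{0,1,2,\dots\}$; dimension is over $\mathbb{R}$. For $\mu\in\mathbb{R}$, $\mathcal{F}_\mu=\{f\,dx^\mu : f\in C^\infty(\mathbb{R})\}$ is the space of $\mu$-densities on $\mathbb{R}$; densities are identified with their coefficient functions. For $h\in C^\infty(\mathbb{R})$ put $X_h=h\frac{d}{dx}$; it acts on $\mathcal{F}_\mu$ by $L^\mu_{X_h}(f)=hf'+\mu h'f$. The bracket is $[X_f,X_g]=X_{fg'-f'g}$. $\mathfrak{aff}(1)$ is the Lie algebra $\mathrm{Span}(X_1,X_x)$. For $\alpha\in\mathbb{N}^n$ and $F=f_1\otimes\cdots\otimes f_n$ let $F^{(\alpha)}=f_1^{(\alpha_1)}\cdots f_n^{(\alpha_n)}$. $\mathrm{D}_{\lambda,\mu}$ is the space of $n$-ary differential operators $\mathcal{F}_{\lambda_1}\otimes\cdots\otimes\mathcal{F}_{\lambda_n}\to\mathcal{F}_\mu$, i.e. of maps $F\mapsto\sum_\alpha a_\alpha F^{(\alpha)}$ (finite sum, $a_\alpha\in C^\infty(\mathbb{R})$). It is an $\mathfrak{aff}(1)$-module via $X_h\cdot A=L^\mu_{X_h}\circ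 A-A\circ L^\lambda_{X_h}$, where $L^\lambda_{X_h}(f_1\otimes\cdots\otimes f_n)=\sum_i f_1\otimes\cdots\otimes L^{\lambda_i}_{X_h}(f_i)\otimes\cdots\otimes f_n$. $\mathrm{H}^1_{\mathrm{diff}}(\mathfrak{aff}(1);\mathrm{D}_{\lambda,\mu})$ is the space of 1-cocycles modulo coboundaries. A 1-cocycle is a linear map $\Omega:\mathfrak{aff}(1)\to\mathrm{D}_{\lambda,\mu}$ (given by differential operators, which is automatic here) with $\Omega([X,Y])=X\cdot\Omega(Y)-Y\cdot\Omega(X)$; coboundaries are the maps $X\mapsto X\cdot b$ with $b\in\mathrm{D}_{\lambda,\mu}$. *)

theory Defs
  imports
    "HOL-Analysis.Derivative"
    "HOL-Library.Function_Algebras"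
    "Jordan_Normal_Form.VS_Connect"
begin

section \<open>Smooth functions on the real line\<close>

primrec differentiable_upto :: "nat \<Rightarrow> (real \<Rightarrow> real) \<Rightarrow> bool" where
  "differentiable_upto 0 f \<longleftrightarrow> (\<forall>x. f field_differentiable at x)"
| "differentiable_upto (Suc k) f \<longleftrightarrow>
     (\<forall>x. f field_differentiable at x) \<and> differentiable_upto k (deriv f)"

definition smooth :: "(real \<Rightarrow> real) \<Rightarrow> bool" where
  "smooth f \<longleftrightarrow> (\<forall>k x. (deriv ^^ k) f field_differentiable at x)"

lemma differentiable_upto_diff:
  "differentiable_upto k f \<Longrightarrow> f field_differentiable at x"
  by (cases k) auto

lemma differentiable_upto_Suc_D:
  "differentiable_upto (Suc k) f \<Longrightarrow> differentiable_upto k f"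
  by (induction k arbitrary: f) auto

lemma differentiable_upto_iff:
  "differentiable_upto k f \<longleftrightarrow> (\<forall>j\<le>k. \<forall>x. (deriv ^^ j) f field_differentiable at x)"
proof (induction k arbitrary: f)
  case (Suc k)
  have "(\<forall>j\<le>Suc k. \<forall>x. (deriv ^^ j) f field_differentiable at x) \<longleftrightarrow>
    (\<forall>x. f field_differentiable at x) \<and>
    (\<forall>j\<le>k. \<forall>x. (deriv ^^ j) (deriv f) field_differentiable at x)"
    (is "?l \<longleftrightarrow> ?r")
  proof
    assume l: ?l
    show ?r
      using l[rule_format, of 0] l[rule_format, of "Suc _"]
      by (auto simp: funpow_Suc_right simp del: funpow.simps)
  next
    assume ?r
    then show ?l
      by (metis Suc_le_mono comp_apply funpow_0 funpow_Suc_right not0_implies_Suc)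
  qed
  then show ?case using Suc.IH by simp
qed auto

lemma smooth_iff: "smooth f \<longleftrightarrow> (\<forall>k. differentiable_upto k f)"
  unfolding smooth_def differentiable_upto_iff by blast

lemma differentiable_upto_const: "differentiable_upto k (\<lambda>_. c)"
proof (induction k arbitrary: c)
  case (Suc k)
  have "deriv (\<lambda>_::real. c) = (\<lambda>_. 0)" by (rule ext) simp
  then show ?case using Suc[of 0] by simp
qed auto

lemma differentiable_upto_add:
  "differentiable_upto k f \<Longrightarrow> differentiable_upto k g \<Longrightarrow>
   differentiable_upto k (\<lambda>x. f x + g x)"
proof (induction k arbitrary: f g)
  case (Suc k)
  then have "deriv (\<lambda>x. f x + g x) = (\<lambda>x. deriv f x + deriv g x)"
    by (intro ext deriv_add) auto
  then show ?case using Suc by (auto intro: field_differentiable_add)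
qed (auto intro: field_differentiable_add)

lemma differentiable_upto_mult:
  "differentiable_upto k f \<Longrightarrow> differentiable_upto k g \<Longrightarrow>
   differentiable_upto k (\<lambda>x. f x * g x)"
proof (induction k arbitrary: f g)
  case (Suc k)
  then have *: "deriv (\<lambda>x. f x * g x) = (\<lambda>x. f x * deriv g x + deriv f x * g x)"
    by (intro ext deriv_mult) auto
  have "differentiable_upto k f" "differentiable_upto k g"
    using Suc.prems differentiable_upto_Suc_D by blast+
  then have "differentiable_upto k (\<lambda>x. f x * deriv g x + deriv f x * g x)"
    using Suc.prems by (intro differentiable_upto_add Suc.IH) auto
  then show ?case using Suc.prems * by (auto intro: field_differentiable_mult)
qed (auto intro: field_differentiable_mult)

lemma differentiable_upto_id: "differentiable_upto k (\<lambda>x. x)"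
proof (cases k)
  case (Suc j)
  have "deriv (\<lambda>x::real. x) = (\<lambda>_. 1)" by (rule ext) simp
  then show ?thesis using Suc differentiable_upto_const by simp
qed auto

lemma smooth_const: "smooth (\<lambda>_. c)"
  and smooth_add: "smooth f \<Longrightarrow> smooth g \<Longrightarrow> smooth (\<lambda>x. f x + g x)"
  and smooth_mult: "smooth f \<Longrightarrow> smooth g \<Longrightarrow> smooth (\<lambda>x. f x * g x)"
  and smooth_id: "smooth (\<lambda>x. x)"
  by (simp_all add: smooth_iff differentiable_upto_const differentiable_upto_add
      differentiable_upto_mult differentiable_upto_id)

lemma smooth_cmult: "smooth f \<Longrightarrow> smooth (\<lambda>x. c * f x)"
  by (rule smooth_mult[OF smooth_const])

lemma smooth_uminus: "smooth f \<Longrightarrow> smooth (\<lambda>x. - f x)"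
  using smooth_cmult[of f "-1"] by simp

lemma smooth_diff: "smooth f \<Longrightarrow> smooth g \<Longrightarrow> smooth (\<lambda>x. f x - g x)"
  using smooth_add[of f "\<lambda>x. - g x"] smooth_uminus[of g] by simp

lemma smooth_deriv: "smooth f \<Longrightarrow> smooth (deriv f)"
  unfolding smooth_iff by (metis differentiable_upto.simps(2))

lemma smooth_differentiable: "smooth f \<Longrightarrow> f field_differentiable at x"
  unfolding smooth_iff using differentiable_upto_diff by blast

typedef smooth = "{f. smooth f}"
  morphisms smooth_apply Smooth
  using smooth_const by blast

setup_lifting type_definition_smooth

instantiation smooth :: comm_ring_1
begin

lift_definition zero_smooth :: smooth is "\<lambda>_. 0" by (rule smooth_const)
lift_definition one_smooth :: smooth is "\<lambda>_. 1" by (rule smooth_const)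
lift_definition plus_smooth :: "smooth \<Rightarrow> smooth \<Rightarrow> smooth" is "\<lambda>f g x. f x + g x"
  by (rule smooth_add)
lift_definition minus_smooth :: "smooth \<Rightarrow> smooth \<Rightarrow> smooth" is "\<lambda>f g x. f x - g x"
  by (rule smooth_diff)
lift_definition uminus_smooth :: "smooth \<Rightarrow> smooth" is "\<lambda>f x. - f x"
  by (rule smooth_uminus)
lift_definition times_smooth :: "smooth \<Rightarrow> smooth \<Rightarrow> smooth" is "\<lambda>f g x. f x * g x"
  by (rule smooth_mult)

instance
  by (standard; transfer) (auto simp: algebra_simps fun_eq_iff)

end

instantiation smooth :: real_algebra_1
begin

lift_definition scaleR_smooth :: "real \<Rightarrow> smooth \<Rightarrow> smooth" is "\<lambda>c f x. c * f x"
  by (rule smooth_cmult)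

instance
  by (standard; transfer) (auto simp: algebra_simps fun_eq_iff)

end

lift_definition smooth_deriv :: "smooth \<Rightarrow> smooth" is deriv by (rule smooth_deriv)

lift_definition smooth_coord :: smooth is "\<lambda>x. x" by (rule smooth_id)

lemma smooth_deriv_add: "smooth_deriv (f + g) = smooth_deriv f + smooth_deriv g"
  by transfer (auto intro!: ext deriv_add smooth_differentiable)

lemma smooth_deriv_mult:
  "smooth_deriv (f * g) = f * smooth_deriv g + smooth_deriv f * g"
  by transfer (auto intro!: ext deriv_mult smooth_differentiable)

lemma smooth_deriv_scaleR: "smooth_deriv (c *\<^sub>R f) = c *\<^sub>R smooth_deriv f"
  by transfer (auto intro!: ext deriv_cmult smooth_differentiable)

lemma smooth_deriv_one [simp]: "smooth_deriv 1 = 0"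
  by transfer auto

lemma smooth_deriv_coord [simp]: "smooth_deriv smooth_coord = 1"
  by transfer auto

lemma linear_smooth_deriv: "linear smooth_deriv"
  by (rule linearI) (rule smooth_deriv_add smooth_deriv_scaleR)+


section \<open>The Lie algebra \<open>aff(1)\<close>\<close>

text \<open>The vector field \<open>X\<^sub>h = h d/dx\<close> is identified with its coefficient \<open>h\<close>.\<close>

definition vf_bracket :: "smooth \<Rightarrow> smooth \<Rightarrow> smooth" where
  "vf_bracket f g = f * smooth_deriv g - smooth_deriv f * g"

typedef aff1 = "real_vector.span {1, smooth_coord}"
  morphisms vf_coeff Aff1
  using real_vector.span_zero by blast

setup_lifting type_definition_aff1

instantiation aff1 :: real_vector
begin

lift_definition zero_aff1 :: aff1 is 0 by (rule real_vector.span_zero)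
lift_definition plus_aff1 :: "aff1 \<Rightarrow> aff1 \<Rightarrow> aff1" is "(+)" by (rule real_vector.span_add)
lift_definition minus_aff1 :: "aff1 \<Rightarrow> aff1 \<Rightarrow> aff1" is "(-)" by (rule real_vector.span_diff)
lift_definition uminus_aff1 :: "aff1 \<Rightarrow> aff1" is uminus by (rule real_vector.span_neg)
lift_definition scaleR_aff1 :: "real \<Rightarrow> aff1 \<Rightarrow> aff1" is scaleR by (rule real_vector.span_scale)

instance
  by (standard; transfer) (auto simp: algebra_simps)

end

lemma aff1_coeffE:
  assumes "h \<in> real_vector.span {1, smooth_coord}"
  obtains a b where "h = a *\<^sub>R 1 + b *\<^sub>R smooth_coord"
proof -
  obtain a where "h - a *\<^sub>R 1 \<in> real_vector.span {smooth_coord}"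
    using assms unfolding real_vector.span_insert by blast
  then obtain b where "h - a *\<^sub>R 1 = b *\<^sub>R smooth_coord"
    unfolding real_vector.span_singleton by blast
  then show ?thesis using that[of a b] by (simp add: algebra_simps)
qed

lemma vf_bracket_aff1:
  assumes "f \<in> real_vector.span {1, smooth_coord}" "g \<in> real_vector.span {1, smooth_coord}"
  shows "vf_bracket f g \<in> real_vector.span {1, smooth_coord}"
proof -
  obtain a b where f: "f = a *\<^sub>R 1 + b *\<^sub>R smooth_coord" using aff1_coeffE[OF assms(1)] .
  obtain c d where g: "g = c *\<^sub>R 1 + d *\<^sub>R smooth_coord" using aff1_coeffE[OF assms(2)] .
  have "vf_bracket f g = (a * d - b * c) *\<^sub>R 1"
    by (simp add: vf_bracket_def f g smooth_deriv_add smooth_deriv_scaleR algebra_simps)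
  then show ?thesis
    by (simp only:) (intro real_vector.span_scale real_vector.span_base; simp)
qed

lift_definition aff1_bracket :: "aff1 \<Rightarrow> aff1 \<Rightarrow> aff1" is vf_bracket
  by (rule vf_bracket_aff1)


section \<open>Densities and differential operators\<close>

text \<open>\<open>lie_density \<mu> h f\<close> is the Lie derivative of the density \<open>f dx\<^sup>\<mu>\<close> along \<open>X\<^sub>h\<close>.\<close>

definition lie_density :: "real \<Rightarrow> smooth \<Rightarrow> smooth \<Rightarrow> smooth" where
  "lie_density \<mu> h f = h * smooth_deriv f + \<mu> *\<^sub>R (smooth_deriv h * f)"

instantiation "fun" :: (type, real_vector) real_vector
begin

definition scaleR_fun_def: "scaleR c f = (\<lambda>x. c *\<^sub>R f x)"

instance
  by standard (auto simp: scaleR_fun_def fun_eq_iff algebra_simps)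

end

text \<open>
  An \<open>n\<close>-ary operator is recorded by its values on the decomposable tensors
  \<open>f\<^sub>1 \<otimes> \<dots> \<otimes> f\<^sub>n\<close>, i.e. as a function of the tuple \<open>F = (f\<^sub>1, \<dots>, f\<^sub>n)\<close>; the index set
  is a finite type \<open>'n\<close> with \<open>n\<close> elements.  As a vector space, the space of
  differential operators depends neither on \<open>\<lambda>\<close> nor on \<open>\<mu>\<close>; these enter through
  the action only.
\<close>

definition tuple_deriv :: "('n::finite \<Rightarrow> nat) \<Rightarrow> ('n \<Rightarrow> smooth) \<Rightarrow> smooth" where
  "tuple_deriv \<alpha> F = (\<Prod>i\<in>UNIV. (smooth_deriv ^^ \<alpha> i) (F i))"

definition diff_ops :: "(('n::finite \<Rightarrow> smooth) \<Rightarrow> smooth) set" where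
  "diff_ops = {A. \<exists>S a. finite S \<and> A = (\<lambda>F. \<Sum>\<alpha>\<in>S. a \<alpha> * tuple_deriv \<alpha> F)}"

text \<open>
  \<open>X\<^sub>h \<cdot> A = L\<^sup>\<mu> \<circ> A - A \<circ> L\<^sup>\<lambda>\<close>.  The \<open>i\<close>-th summand of \<open>L\<^sup>\<lambda>(f\<^sub>1 \<otimes> \<dots> \<otimes> f\<^sub>n)\<close> is the
  decomposable tensor of the tuple updated at \<open>i\<close>, and \<open>A\<close> is additive on tensors.
\<close>

definition op_action ::
  "('n::finite \<Rightarrow> real) \<Rightarrow> real \<Rightarrow> smooth \<Rightarrow> (('n \<Rightarrow> smooth) \<Rightarrow> smooth) \<Rightarrow> ('n \<Rightarrow> smooth) \<Rightarrow> smooth" where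
  "op_action lam \<mu> h A =
     (\<lambda>F. lie_density \<mu> h (A F) - (\<Sum>i\<in>UNIV. A (F(i := lie_density (lam i) h (F i)))))"


section \<open>Quotient vector spaces\<close>

definition vcoset :: "'a::real_vector set \<Rightarrow> 'a \<Rightarrow> 'a set" where
  "vcoset B z = {z + b | b. b \<in> B}"

text \<open>
  The quotient \<open>Z / B\<close> of real vector spaces \<open>B \<subseteq> Z\<close>.  The fields \<open>mult\<close> and \<open>one\<close>
  of the module record play no role.
\<close>

definition quotient_space :: "'a::real_vector set \<Rightarrow> 'a set \<Rightarrow> (real, 'a set) module" where
  "quotient_space Z B =
    \<lparr> carrier = vcoset B ` Z,
      mult = undefined,
      one = undefined,
      zero = B,
      add = (\<lambda>C E. {c + e | c e. c \<in> C \<and> e \<in> E}),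
      smult = (\<lambda>r C. {r *\<^sub>R c + b | c b. c \<in> C \<and> b \<in> B}) \<rparr>"

context
  fixes Z B :: "'a::real_vector set"
  assumes Z: "real_vector.subspace Z" and B: "real_vector.subspace B" and BZ: "B \<subseteq> Z"
begin

lemma vcoset_eq_iff: "vcoset B x = vcoset B y \<longleftrightarrow> x - y \<in> B"
proof
  assume "vcoset B x = vcoset B y"
  moreover have "x \<in> vcoset B x"
    using real_vector.subspace_0[OF B] by (force simp: vcoset_def)
  ultimately obtain b where "x = y + b" "b \<in> B" by (auto simp: vcoset_def)
  then show "x - y \<in> B" by simp
next
  have *: "vcoset B x \<subseteq> vcoset B y" if "x - y \<in> B" for x y
  proof
    fix z assume "z \<in> vcoset B x"
    then obtain b where b: "z = x + b" "b \<in> B" by (auto simp: vcoset_def)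
    then have "z = y + ((x - y) + b)" by simp
    then show "z \<in> vcoset B y"
      using real_vector.subspace_add[OF B that b(2)] unfolding vcoset_def by blast
  qed
  assume xy: "x - y \<in> B"
  then have "y - x \<in> B" using real_vector.subspace_neg[OF B xy] by simp
  then show "vcoset B x = vcoset B y" using * xy by blast
qed

lemma vcoset_0: "vcoset B 0 = B"
  by (simp add: vcoset_def)

lemma quotient_add: "vcoset B x \<oplus>\<^bsub>quotient_space Z B\<^esub> vcoset B y = vcoset B (x + y)"
proof -
  have "{c + e | c e. c \<in> vcoset B x \<and> e \<in> vcoset B y} = vcoset B (x + y)" (is "?l = ?r")
  proof
    show "?l \<subseteq> ?r"
    proof
      fix z assume "z \<in> ?l"
      then obtain b b' where *: "z = (x + b) + (y + b')" "b \<in> B" "b' \<in> B"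
        by (auto simp: vcoset_def)
      then have "z = x + y + (b + b')" by simp
      then show "z \<in> ?r"
        using real_vector.subspace_add[OF B *(2,3)] unfolding vcoset_def by blast
    qed
    show "?r \<subseteq> ?l"
    proof
      fix z assume "z \<in> ?r"
      then obtain b where "z = x + y + b" "b \<in> B" by (auto simp: vcoset_def)
      then have "z = (x + 0) + (y + b)" "b \<in> B" "0 \<in> B"
        using real_vector.subspace_0[OF B] by auto
      then show "z \<in> ?l" unfolding vcoset_def by blast
    qed
  qed
  then show ?thesis by (simp add: quotient_space_def)
qed

lemma quotient_smult: "r \<odot>\<^bsub>quotient_space Z B\<^esub> vcoset B x = vcoset B (r *\<^sub>R x)"
proof -
  have "{r *\<^sub>R c + b | c b. c \<in> vcoset B x \<and> b \<in> B} = vcoset B (r *\<^sub>R x)" (is "?l = ?r")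
  proof
    show "?l \<subseteq> ?r"
    proof
      fix z assume "z \<in> ?l"
      then obtain b b' where *: "z = r *\<^sub>R (x + b) + b'" "b \<in> B" "b' \<in> B"
        by (auto simp: vcoset_def)
      then have "z = r *\<^sub>R x + (r *\<^sub>R b + b')" by (simp add: scaleR_add_right)
      then show "z \<in> ?r"
        using real_vector.subspace_add[OF B real_vector.subspace_scale[OF B *(2)] *(3)]
        unfolding vcoset_def by blast
    qed
    show "?r \<subseteq> ?l"
    proof
      fix z assume "z \<in> ?r"
      then obtain b where "z = r *\<^sub>R x + b" "b \<in> B" by (auto simp: vcoset_def)
      then have "z = r *\<^sub>R (x + 0) + b" "b \<in> B" "0 \<in> B"
        using real_vector.subspace_0[OF B] by auto
      then show "z \<in> ?l" unfolding vcoset_def by blast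
    qed
  qed
  then show ?thesis by (simp add: quotient_space_def)
qed

lemma carrier_quotient: "carrier (quotient_space Z B) = vcoset B ` Z"
  and zero_quotient: "\<zero>\<^bsub>quotient_space Z B\<^esub> = vcoset B 0"
  by (simp_all add: quotient_space_def vcoset_0)

lemma vectorspace_quotient: "vectorspace class_ring (quotient_space Z B)"
proof -
  note q = carrier_quotient zero_quotient quotient_add quotient_smult
  have "abelian_group (quotient_space Z B)"
  proof (rule abelian_groupI)
    fix C assume "C \<in> carrier (quotient_space Z B)"
    then obtain z where z: "C = vcoset B z" "z \<in> Z" by (auto simp: q)
    then show "\<exists>E\<in>carrier (quotient_space Z B). E \<oplus>\<^bsub>quotient_space Z B\<^esub> C = \<zero>\<^bsub>quotient_space Z B\<^esub>"
      using real_vector.subspace_neg[OF Z z(2)]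
      by (intro bexI[of _ "vcoset B (- z)"]) (auto simp: q)
  qed (use real_vector.subspace_add[OF Z] real_vector.subspace_0[OF Z]
        in \<open>auto simp: q algebra_simps\<close>)
  moreover have "Module.module_axioms class_ring (quotient_space Z B)"
    by standard (use real_vector.subspace_scale[OF Z] in \<open>auto simp: q algebra_simps\<close>)
  ultimately show ?thesis
    unfolding vectorspace_def Module.module_def
    using class_field.field_axioms class_cring.cring_axioms by blast
qed

end


section \<open>First cohomology\<close>

definition cocycles ::
  "('n::finite \<Rightarrow> real) \<Rightarrow> real \<Rightarrow> (aff1 \<Rightarrow> ('n \<Rightarrow> smooth) \<Rightarrow> smooth) set" where
  "cocycles lam \<mu> = {\<Omega>. linear \<Omega> \<and> range \<Omega> \<subseteq> diff_ops \<and>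
     (\<forall>X Y. \<Omega> (aff1_bracket X Y) =
        op_action lam \<mu> (vf_coeff X) (\<Omega> Y) - op_action lam \<mu> (vf_coeff Y) (\<Omega> X))}"

definition coboundaries ::
  "('n::finite \<Rightarrow> real) \<Rightarrow> real \<Rightarrow> (aff1 \<Rightarrow> ('n \<Rightarrow> smooth) \<Rightarrow> smooth) set" where
  "coboundaries lam \<mu> = {(\<lambda>X. op_action lam \<mu> (vf_coeff X) A) | A. A \<in> diff_ops}"

definition H1_diff ::
  "('n::finite \<Rightarrow> real) \<Rightarrow> real \<Rightarrow> (real, (aff1 \<Rightarrow> ('n \<Rightarrow> smooth) \<Rightarrow> smooth) set) module" where
  "H1_diff lam \<mu> = quotient_space (cocycles lam \<mu>) (coboundaries lam \<mu>)"


subsection \<open>\<open>H\<^sup>1\<close> is a vector space\<close>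

text \<open>
  \<open>vectorspace.dim\<close> is meaningful only for vector spaces, so we check that the
  coboundaries form a subspace of the space of cocycles.
\<close>

lemma smooth_deriv_prod:
  "finite I \<Longrightarrow>
   smooth_deriv (\<Prod>i\<in>I. f i) = (\<Sum>i\<in>I. smooth_deriv (f i) * (\<Prod>j\<in>I - {i}. f j))"
proof (induction I rule: finite_induct)
  case (insert x I)
  have "(\<Prod>j\<in>insert x I - {i}. f j) = f x * (\<Prod>j\<in>I - {i}. f j)" if "i \<in> I" for i
  proof -
    have "insert x I - {i} = insert x (I - {i})" using that insert.hyps by auto
    then show ?thesis using insert.hyps by simp
  qed
  then have "(\<Sum>i\<in>I. smooth_deriv (f i) * (\<Prod>j\<in>insert x I - {i}. f j))
    = f x * (\<Sum>i\<in>I. smooth_deriv (f i) * (\<Prod>j\<in>I - {i}. f j))"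
    by (simp add: sum_distrib_left mult_ac)
  moreover have "insert x I - {x} = I" using insert.hyps by auto
  ultimately show ?case
    using insert by (simp add: smooth_deriv_mult)
qed simp

lemma smooth_deriv_pow_lie_density:
  assumes "smooth_deriv (smooth_deriv h) = 0"
  shows "(smooth_deriv ^^ m) (lie_density c h f) =
    h * (smooth_deriv ^^ Suc m) f + (of_nat m + c) *\<^sub>R (smooth_deriv h * (smooth_deriv ^^ m) f)"
proof (induction m)
  case (Suc m)
  then show ?case
    using assms
    by (simp add: smooth_deriv_add smooth_deriv_mult smooth_deriv_scaleR algebra_simps)
qed (simp add: lie_density_def)

definition monomial_op :: "('n::finite \<Rightarrow> nat) \<Rightarrow> smooth \<Rightarrow> ('n \<Rightarrow> smooth) \<Rightarrow> smooth" where
  "monomial_op \<alpha> a = (\<lambda>F. a * tuple_deriv \<alpha> F)"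

lemma op_action_monomial:
  fixes \<alpha> :: "'n::finite \<Rightarrow> nat"
  assumes h: "smooth_deriv (smooth_deriv h) = 0"
  shows "op_action lam \<mu> h (monomial_op \<alpha> a) =
    monomial_op \<alpha> (lie_density (\<mu> - (\<Sum>i\<in>UNIV. lam i) - real (\<Sum>i\<in>UNIV. \<alpha> i)) h a)"
proof
  fix F :: "'n \<Rightarrow> smooth"
  let ?D = smooth_deriv
  let ?T = "tuple_deriv \<alpha> F"
  let ?P = "\<lambda>i. \<Prod>j\<in>UNIV - {i}. (?D ^^ \<alpha> j) (F j)"
  have T: "?T = (?D ^^ \<alpha> i) (F i) * ?P i" for i
    unfolding tuple_deriv_def by (subst prod.remove[of _ i]) auto
  have upd: "tuple_deriv \<alpha> (F(i := g)) = (?D ^^ \<alpha> i) g * ?P i" for i g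
    unfolding tuple_deriv_def by (subst prod.remove[of _ i]) auto
  have D: "?D ?T = (\<Sum>i\<in>UNIV. (?D ^^ Suc (\<alpha> i)) (F i) * ?P i)"
    unfolding tuple_deriv_def by (simp add: smooth_deriv_prod)
  have "monomial_op \<alpha> a (F(i := lie_density (lam i) h (F i))) =
     a * h * ((?D ^^ Suc (\<alpha> i)) (F i) * ?P i) + (real (\<alpha> i) + lam i) *\<^sub>R (a * ?D h * ?T)" for i
    unfolding monomial_op_def upd smooth_deriv_pow_lie_density[OF h]
    by (subst T[of i]) (simp add: algebra_simps)
  then have "(\<Sum>i\<in>UNIV. monomial_op \<alpha> a (F(i := lie_density (lam i) h (F i)))) =
     a * h * ?D ?T + (\<Sum>i\<in>UNIV. real (\<alpha> i) + lam i) *\<^sub>R (a * ?D h * ?T)"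
    unfolding D by (simp only: sum.distrib[symmetric] sum_distrib_left scaleR_sum_left)
  then show "op_action lam \<mu> h (monomial_op \<alpha> a) F =
    monomial_op \<alpha> (lie_density (\<mu> - (\<Sum>i\<in>UNIV. lam i) - real (\<Sum>i\<in>UNIV. \<alpha> i)) h a) F"
    by (simp add: op_action_def monomial_op_def lie_density_def smooth_deriv_mult
        sum.distrib algebra_simps)
qed

lemma linear_lie_density: "linear (lie_density \<mu> h)"
  by (rule linearI)
    (simp_all add: lie_density_def smooth_deriv_add smooth_deriv_scaleR algebra_simps)

lemma linear_lie_density_field: "linear (\<lambda>h. lie_density \<mu> h f)"
  by (rule linearI)
    (simp_all add: lie_density_def smooth_deriv_add smooth_deriv_scaleR algebra_simps)

lemma lie_density_bracket:
  "lie_density \<nu> (vf_bracket f g) a =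
   lie_density \<nu> f (lie_density \<nu> g a) - lie_density \<nu> g (lie_density \<nu> f a)"
  unfolding lie_density_def vf_bracket_def
  by (simp add: smooth_deriv_add smooth_deriv_mult smooth_deriv_scaleR algebra_simps
      linear_diff[OF linear_smooth_deriv])

lemma linear_op_action:
  fixes lam :: "'n::finite \<Rightarrow> real"
  shows "linear (op_action lam \<mu> h)"
proof (rule linearI)
  fix A B :: "('n \<Rightarrow> smooth) \<Rightarrow> smooth" and c :: real
  show "op_action lam \<mu> h (A + B) = op_action lam \<mu> h A + op_action lam \<mu> h B"
    by (rule ext) (simp add: op_action_def linear_add[OF linear_lie_density] sum.distrib)
  show "op_action lam \<mu> h (c *\<^sub>R A) = c *\<^sub>R op_action lam \<mu> h A"
    by (rule ext) (simp add: op_action_def scaleR_fun_def linear_scale[OF linear_lie_density]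
        scaleR_sum_right algebra_simps)
qed

lemma diff_ops_altdef:
  "diff_ops = {\<Sum>\<alpha>\<in>S. monomial_op \<alpha> (a \<alpha>) | S a. finite S}"
proof -
  have "(\<lambda>F. \<Sum>\<alpha>\<in>S. a \<alpha> * tuple_deriv \<alpha> F) = (\<Sum>\<alpha>\<in>S. monomial_op \<alpha> (a \<alpha>))"
    for S :: "('n::finite \<Rightarrow> nat) set" and a
    by (induction S rule: infinite_finite_induct) (auto simp: monomial_op_def fun_eq_iff)
  then show ?thesis unfolding diff_ops_def by (auto; metis)
qed

lemma sum_monomial_op_in_diff_ops:
  "finite S \<Longrightarrow> (\<Sum>\<alpha>\<in>S. monomial_op \<alpha> (a \<alpha>)) \<in> diff_ops"
  unfolding diff_ops_altdef by blast

lemma linear_monomial_op: "linear (monomial_op \<alpha>)"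
  by (rule linearI) (auto simp: monomial_op_def scaleR_fun_def fun_eq_iff algebra_simps)

lemma subspace_diff_ops:
  "real_vector.subspace (diff_ops :: (('n::finite \<Rightarrow> smooth) \<Rightarrow> smooth) set)"
proof (rule real_vector.subspaceI)
  show "(0 :: ('n \<Rightarrow> smooth) \<Rightarrow> smooth) \<in> diff_ops"
    unfolding diff_ops_altdef mem_Collect_eq by (rule exI[of _ "{}"]) simp
next
  fix A B :: "('n \<Rightarrow> smooth) \<Rightarrow> smooth"
  assume "A \<in> diff_ops" "B \<in> diff_ops"
  then obtain S a T b where A: "A = (\<Sum>\<alpha>\<in>S. monomial_op \<alpha> (a \<alpha>))" "finite S"
    and B: "B = (\<Sum>\<alpha>\<in>T. monomial_op \<alpha> (b \<alpha>))" "finite T"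
    unfolding diff_ops_altdef by blast
  let ?c = "\<lambda>\<alpha>. (if \<alpha> \<in> S then a \<alpha> else 0) + (if \<alpha> \<in> T then b \<alpha> else 0)"
  have 0: "monomial_op \<alpha> 0 = 0" for \<alpha> :: "'n \<Rightarrow> nat"
    by (rule linear_0[OF linear_monomial_op])
  have "A = (\<Sum>\<alpha>\<in>S \<union> T. monomial_op \<alpha> (if \<alpha> \<in> S then a \<alpha> else 0))"
    unfolding A(1) using A(2) B(2) by (intro sum.mono_neutral_cong_left) (auto simp: 0)
  moreover have "B = (\<Sum>\<alpha>\<in>S \<union> T. monomial_op \<alpha> (if \<alpha> \<in> T then b \<alpha> else 0))"
    unfolding B(1) using A(2) B(2) by (intro sum.mono_neutral_cong_left) (auto simp: 0)
  ultimately have "A + B = (\<Sum>\<alpha>\<in>S \<union> T. monomial_op \<alpha> (?c \<alpha>))"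
    by (simp only: linear_add[OF linear_monomial_op] sum.distrib)
  then show "A + B \<in> diff_ops"
    using sum_monomial_op_in_diff_ops[of "S \<union> T" ?c] A(2) B(2) by simp
next
  fix c and A :: "('n \<Rightarrow> smooth) \<Rightarrow> smooth"
  assume "A \<in> diff_ops"
  then obtain S a where A: "A = (\<Sum>\<alpha>\<in>S. monomial_op \<alpha> (a \<alpha>))" "finite S"
    unfolding diff_ops_altdef by blast
  have "c *\<^sub>R A = (\<Sum>\<alpha>\<in>S. monomial_op \<alpha> (c *\<^sub>R a \<alpha>))"
    by (simp add: A scaleR_sum_right linear_scale[OF linear_monomial_op])
  then show "c *\<^sub>R A \<in> diff_ops"
    using sum_monomial_op_in_diff_ops[OF A(2), of "\<lambda>\<alpha>. c *\<^sub>R a \<alpha>"] by simp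
qed

lemma vf_coeff_affine [simp]: "smooth_deriv (smooth_deriv (vf_coeff X)) = 0"
proof -
  obtain a b where "vf_coeff X = a *\<^sub>R 1 + b *\<^sub>R smooth_coord"
    using aff1_coeffE[OF vf_coeff] .
  then show ?thesis by (simp add: smooth_deriv_add smooth_deriv_scaleR)
qed

lemma op_action_sum:
  "op_action lam \<mu> (vf_coeff X) (\<Sum>\<alpha>\<in>S. monomial_op \<alpha> (a \<alpha>)) =
   (\<Sum>\<alpha>\<in>S. monomial_op \<alpha>
      (lie_density (\<mu> - (\<Sum>i\<in>UNIV. lam i) - real (\<Sum>i\<in>UNIV. \<alpha> i)) (vf_coeff X) (a \<alpha>)))"
  by (simp add: linear_sum[OF linear_op_action] op_action_monomial)

lemma subspace_cocycles: "real_vector.subspace (cocycles lam \<mu>)"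
proof (rule real_vector.subspaceI)
  show "0 \<in> cocycles lam \<mu>"
    by (auto simp: cocycles_def linear_0[OF linear_op_action]
        intro!: linearI real_vector.subspace_0[OF subspace_diff_ops])
next
  fix \<Omega> \<Psi> assume "\<Omega> \<in> cocycles lam \<mu>" "\<Psi> \<in> cocycles lam \<mu>"
  moreover from this have "linear (\<Omega> + \<Psi>)"
    by (auto simp: cocycles_def linear_add linear_scale scaleR_add_right intro!: linearI)
  ultimately show "\<Omega> + \<Psi> \<in> cocycles lam \<mu>"
    by (auto simp: cocycles_def image_subset_iff linear_add[OF linear_op_action]
        intro!: real_vector.subspace_add[OF subspace_diff_ops])
next
  fix c \<Omega> assume "\<Omega> \<in> cocycles lam \<mu>"
  moreover from this have "linear (c *\<^sub>R \<Omega>)"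
    by (auto simp: cocycles_def linear_add linear_scale scaleR_fun_def[of c \<Omega>]
        scaleR_add_right intro!: linearI)
  ultimately show "c *\<^sub>R \<Omega> \<in> cocycles lam \<mu>"
    by (auto simp: cocycles_def image_subset_iff scaleR_fun_def[of c \<Omega>]
        linear_scale[OF linear_op_action] scaleR_diff_right
        intro!: real_vector.subspace_scale[OF subspace_diff_ops])
qed

lemma subspace_coboundaries: "real_vector.subspace (coboundaries lam \<mu>)"
proof -
  let ?d = "\<lambda>A X. op_action lam \<mu> (vf_coeff X) A"
  have "linear ?d"
    by (rule linearI)
      (auto simp: linear_add[OF linear_op_action] linear_scale[OF linear_op_action]
        scaleR_fun_def[of _ "\<lambda>X::aff1. _ X"] fun_eq_iff)
  moreover have "coboundaries lam \<mu> = ?d ` diff_ops"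
    by (auto simp: coboundaries_def)
  ultimately show ?thesis
    using real_vector.linear_subspace_image subspace_diff_ops by metis
qed

lemma coboundaries_subset_cocycles:
  fixes lam :: "'n::finite \<Rightarrow> real"
  shows "coboundaries lam \<mu> \<subseteq> cocycles lam \<mu>"
proof
  fix \<Omega> assume "\<Omega> \<in> coboundaries lam \<mu>"
  then obtain S a where S: "finite S"
    and \<Omega>: "\<Omega> = (\<lambda>X. op_action lam \<mu> (vf_coeff X) (\<Sum>\<alpha>\<in>S. monomial_op \<alpha> (a \<alpha>)))"
    by (auto simp: coboundaries_def diff_ops_altdef)
  define \<nu> where "\<nu> \<alpha> = \<mu> - (\<Sum>i\<in>UNIV. lam i) - real (\<Sum>i\<in>UNIV. \<alpha> i)"
    for \<alpha> :: "'n \<Rightarrow> nat"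
  have \<Omega>': "\<Omega> = (\<lambda>X. \<Sum>\<alpha>\<in>S. monomial_op \<alpha> (lie_density (\<nu> \<alpha>) (vf_coeff X) (a \<alpha>)))"
    unfolding \<Omega> op_action_sum \<nu>_def ..
  have "linear \<Omega>"
    unfolding \<Omega>'
    by (rule linearI)
      (simp_all add: plus_aff1.rep_eq scaleR_aff1.rep_eq sum.distrib scaleR_sum_right
        linear_add[OF linear_lie_density_field] linear_scale[OF linear_lie_density_field]
        linear_add[OF linear_monomial_op] linear_scale[OF linear_monomial_op])
  moreover have "range \<Omega> \<subseteq> diff_ops"
    unfolding \<Omega>' using S by (auto intro: sum_monomial_op_in_diff_ops)
  moreover have "\<Omega> (aff1_bracket X Y) =
     op_action lam \<mu> (vf_coeff X) (\<Omega> Y) - op_action lam \<mu> (vf_coeff Y) (\<Omega> X)" for X Y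
    unfolding \<Omega>' op_action_sum \<nu>_def[symmetric] aff1_bracket.rep_eq lie_density_bracket
    by (simp add: linear_diff[OF linear_monomial_op] sum_subtractf)
  ultimately show "\<Omega> \<in> cocycles lam \<mu>"
    by (simp add: cocycles_def)
qed

lemma vectorspace_H1_diff: "vectorspace class_ring (H1_diff lam \<mu>)"
  unfolding H1_diff_def
  by (rule vectorspace_quotient[OF subspace_cocycles subspace_coboundaries
        coboundaries_subset_cocycles])

end

theory Submission
  imports Defs "HOL-Analysis.Interval_Integral"
begin

text \<open>
  On the operator \<open>F \<mapsto> a F\<^sup>(\<^sup>\<alpha>\<^sup>)\<close> the field \<open>X\<^sub>h\<close> acts through the coefficient \<open>a\<close>, a density of
  weight \<open>\<nu> = k - \<bar>\<alpha>\<bar>\<close>.  Writing \<open>p\<close>, \<open>q\<close> for the \<open>\<alpha>\<close>-coefficients of \<open>\<Omega> X\<^sub>1\<close>, \<open>\<Omega> X\<^sub>x\<close>, the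
  cocycle condition reads \<open>p = q' - (x p' + \<nu> p)\<close>, and a coboundary is given by \<open>p = b'\<close>,
  \<open>q = x b' + \<nu> b\<close>.  If \<open>b\<close> is an antiderivative of \<open>p\<close>, then \<open>x b' + \<nu> b\<close> and \<open>q\<close> have the same
  derivative, so only the value at \<open>0\<close> has to be matched.  For \<open>\<nu> \<noteq> 0\<close> this fixes \<open>b 0\<close>; for
  \<open>\<nu> = 0\<close> the obstruction is \<open>q 0\<close>.  Hence the numbers \<open>q\<^sub>\<alpha> 0\<close> with \<open>\<bar>\<alpha>\<bar> = k\<close> are coordinates
  on \<open>H\<^sup>1\<close>.
\<close>

section \<open>Multi-indices and quotient dimensions\<close>

text \<open>Multi-indices are multiplicity functions: as \<open>'n\<close> is finite, every function
  \<open>'n \<Rightarrow> nat\<close> is the \<open>count\<close> of a multiset, whose size is the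
  order of the multi-index. Counting multisets then gives the binomial coefficient.\<close>

lemma bij_betw_count_multi_indices:
  "bij_betw count (multisets_of_size UNIV k) {\<alpha> :: 'n::finite \<Rightarrow> nat. sum \<alpha> UNIV = k}"
proof (rule bij_betw_byWitness[where f' = Abs_multiset])
  have size: "size M = sum (count M) UNIV" for M :: "'n multiset"
    unfolding size_multiset_overloaded_eq
    by (rule sum.mono_neutral_left) (auto simp: count_eq_zero_iff)
  then show "count ` multisets_of_size UNIV k \<subseteq> {\<alpha> :: 'n \<Rightarrow> nat. sum \<alpha> UNIV = k}"
    by (auto simp: multisets_of_size_def)
  show "Abs_multiset ` {\<alpha> :: 'n \<Rightarrow> nat. sum \<alpha> UNIV = k} \<subseteq> multisets_of_size UNIV k"
    by (auto simp: multisets_of_size_def size count_Abs_multiset)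
qed (auto simp: count_inverse count_Abs_multiset)

lemma card_multi_indices:
  "card {\<alpha> :: 'n::finite \<Rightarrow> nat. sum \<alpha> UNIV = k} = (CARD('n) + k - 1) choose k"
  using bij_betw_same_card[OF bij_betw_count_multi_indices[where 'n = 'n and k = k]]
  by (simp add: card_multisets_of_size)

lemma finite_multi_indices: "finite {\<alpha> :: 'n::finite \<Rightarrow> nat. sum \<alpha> UNIV = k}"
  using bij_betw_finite[OF bij_betw_count_multi_indices[where 'n = 'n and k = k]]
  by (simp add: finite_multisets_of_size)

text \<open>The functionals \<open>\<phi> i\<close> descend to the quotient, are jointly injective
  there, and are dual to the classes of the \<open>e i\<close>; so these classes form a basis.
  Finite dimension is recorded as well, since \<open>dim\<close> is meaningful only if a finite
  generating set exists.\<close>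

lemma dim_quotient_space:
  fixes Z B :: "'a::real_vector set" and \<phi> :: "'i \<Rightarrow> 'a \<Rightarrow> real"
  assumes Z: "real_vector.subspace Z" and B: "real_vector.subspace B"
    and I: "finite I"
    and lin: "\<And>i. i \<in> I \<Longrightarrow> linear (\<phi> i)"
    and kernel: "B = {z \<in> Z. \<forall>i\<in>I. \<phi> i z = 0}"
    and e: "\<And>i. i \<in> I \<Longrightarrow> e i \<in> Z"
    and dual: "\<And>i j. i \<in> I \<Longrightarrow> j \<in> I \<Longrightarrow> \<phi> i (e j) = of_bool (i = j)"
  shows "vectorspace.fin_dim class_ring (quotient_space Z B) \<and>
         vectorspace.dim class_ring (quotient_space Z B) = card I"
proof -
  have BZ: "B \<subseteq> Z" using kernel by auto
  interpret V: vectorspace "class_ring :: real ring" "quotient_space Z B"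
    by (rule vectorspace_quotient[OF Z B BZ])
  define v where "v i = vcoset B (e i)" for i
  let ?A = "v ` I"
  have \<phi>_sum: "\<phi> j (\<Sum>i\<in>I. c i *\<^sub>R e i) = c j" if "j \<in> I" for c j
  proof -
    have "\<phi> j (\<Sum>i\<in>I. c i *\<^sub>R e i) = (\<Sum>i\<in>I. c i * of_bool (j = i))"
      using dual[OF that]
      by (simp add: linear_sum[OF lin[OF that]] linear_scale[OF lin[OF that]])
    also have "\<dots> = c j"
      using I that by (simp add: of_bool_def if_distrib cong: if_cong)
    finally show ?thesis .
  qed
  have \<phi>_e_diff: "\<phi> i (e i - e j) = 1" if "i \<in> I" "j \<in> I" "i \<noteq> j" for i j
    using that dual by (simp add: linear_diff[OF lin])
  have inj: "inj_on v I"
  proof (rule inj_onI)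
    fix i j assume ij: "i \<in> I" "j \<in> I" "v i = v j"
    then have "e i - e j \<in> B" by (simp add: v_def vcoset_eq_iff[OF Z B BZ])
    then have "\<phi> i (e i - e j) = 0" using kernel ij by simp
    then show "i = j" using \<phi>_e_diff[OF ij(1,2)] by auto
  qed
  have A: "finite ?A" "?A \<subseteq> carrier (quotient_space Z B)"
    using I e by (auto simp: v_def carrier_quotient[OF Z B BZ])
  have finsum: "finsum (quotient_space Z B) (\<lambda>i. vcoset B (f i)) J = vcoset B (sum f J)"
    if "finite J" "f ` J \<subseteq> Z" for f and J :: "'i set"
    using that
  proof (induction J rule: finite_induct)
    case empty
    then show ?case by (simp add: zero_quotient[OF Z B BZ])
  next
    case (insert i J)
    then show ?case
      by (subst V.finsum_insert)
        (auto simp: carrier_quotient[OF Z B BZ] quotient_add[OF Z B BZ])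
  qed
  have lincomb: "V.lincomb a ?A = vcoset B (\<Sum>i\<in>I. a (v i) *\<^sub>R e i)" for a
  proof -
    have "V.lincomb a ?A = finsum (quotient_space Z B) (\<lambda>i. a (v i) \<odot>\<^bsub>quotient_space Z B\<^esub> v i) I"
      unfolding V.lincomb_def using A(2) inj by (subst V.finsum_reindex) auto
    also have "\<dots> = finsum (quotient_space Z B) (\<lambda>i. vcoset B (a (v i) *\<^sub>R e i)) I"
      by (simp add: v_def quotient_smult[OF Z B BZ])
    also have "\<dots> = vcoset B (\<Sum>i\<in>I. a (v i) *\<^sub>R e i)"
      using I e real_vector.subspace_scale[OF Z] by (intro finsum) auto
    finally show ?thesis .
  qed
  have indpt: "V.lin_indpt ?A"
  proof (rule V.finite_lin_indpt2[OF A])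
    fix a assume "V.lincomb a ?A = \<zero>\<^bsub>quotient_space Z B\<^esub>"
    then have "(\<Sum>i\<in>I. a (v i) *\<^sub>R e i) \<in> B"
      by (simp add: lincomb zero_quotient[OF Z B BZ] vcoset_eq_iff[OF Z B BZ])
    then have "a (v j) = 0" if "j \<in> I" for j
      using \<phi>_sum[OF that, of "\<lambda>i. a (v i)"] kernel that by auto
    then show "\<forall>x\<in>?A. a x = \<zero>\<^bsub>class_ring\<^esub>" by auto
  qed
  have gen: "V.span ?A = carrier (quotient_space Z B)"
  proof
    show "V.span ?A \<subseteq> carrier (quotient_space Z B)"
      using A(2) by (rule V.span_is_subset2)
    show "carrier (quotient_space Z B) \<subseteq> V.span ?A"
    proof
      fix C assume "C \<in> carrier (quotient_space Z B)"
      then obtain z where z: "C = vcoset B z" "z \<in> Z" by (auto simp: carrier_quotient[OF Z B BZ])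
      \<comment> \<open>Coefficients must be functions of cosets, so the index is recovered from the
        coset; by injectivity \<open>a (v i) = \<phi> i z\<close>.\<close>
      define a where "a x = \<phi> (inv_into I v x) z" for x
      let ?s = "\<Sum>i\<in>I. a (v i) *\<^sub>R e i"
      have "?s \<in> Z"
        using e by (intro real_vector.subspace_sum[OF Z] real_vector.subspace_scale[OF Z])
      then have "z - ?s \<in> Z" using z(2) by (intro real_vector.subspace_diff[OF Z])
      moreover have "\<phi> j (z - ?s) = 0" if "j \<in> I" for j
        using that \<phi>_sum[OF that, of "\<lambda>i. a (v i)"] inj
        by (simp add: linear_diff[OF lin] a_def)
      ultimately have "z - ?s \<in> B" using kernel by simp
      then have "C = V.lincomb a ?A"
        by (simp add: z(1) lincomb vcoset_eq_iff[OF Z B BZ])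
      then show "C \<in> V.span ?A"
        using A(1) unfolding V.span_def by auto
    qed
  qed
  have "V.fin_dim"
    using A gen unfolding V.fin_dim_def by blast
  moreover have "V.dim = card I"
    using V.dim_basis[OF A(1)] indpt gen A(2) card_image[OF inj] by (simp add: V.basis_def)
  ultimately show ?thesis ..
qed

section \<open>Smooth functions and coefficients of differential operators\<close>

text \<open>The fundamental theorem of calculus on the whole line gives some antiderivative, and
  adding a constant adjusts its value at 0.\<close>

lemma smooth_antiderivative:
  obtains g where "smooth_deriv g = f" "smooth_apply g 0 = c"
proof -
  let ?f = "smooth_apply f"
  have sm: "smooth ?f" using smooth_apply by simp
  then have "isCont ?f x" for x
    by (intro field_differentiable_imp_continuous_at smooth_differentiable)
  then obtain F where F: "\<And>x. (F has_vector_derivative ?f x) (at x)"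
    using einterval_antiderivative[of "-\<infinity>" "\<infinity>" ?f] by auto
  define G where "G x = F x - F 0 + c" for x
  have G: "(G has_field_derivative ?f x) (at x)" for x
    using F[of x] unfolding G_def has_real_derivative_iff_has_vector_derivative
    by (auto intro!: derivative_eq_intros)
  then have "deriv G = ?f" "\<And>x. G field_differentiable at x"
    by (auto simp: DERIV_imp_deriv field_differentiable_def)
  \<comment> \<open>Beyond order 0, differentiability of \<open>G\<close> is that of its derivative
    \<open>f\<close> one order lower.\<close>
  moreover from this have "differentiable_upto k G" for k
    using sm by (cases k) (auto simp: smooth_iff)
  ultimately have "smooth G" by (simp add: smooth_iff)
  then have apply_G: "smooth_apply (Smooth G) = G" by (simp add: Smooth_inverse)
  have "smooth_deriv (Smooth G) = f"
    using \<open>deriv G = ?f\<close> by (simp add: smooth_apply_inject[symmetric] smooth_deriv.rep_eq apply_G)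
  moreover have "smooth_apply (Smooth G) 0 = c"
    by (simp add: apply_G G_def)
  ultimately show ?thesis using that by blast
qed

lemma smooth_eqI_deriv:
  assumes "smooth_deriv f = smooth_deriv g" "smooth_apply f 0 = smooth_apply g 0"
  shows "f = g"
proof -
  have "smooth_deriv (f - g) = 0"
    using assms(1) by (simp add: linear_diff[OF linear_smooth_deriv])
  then have "deriv (smooth_apply (f - g)) = (\<lambda>_. 0)"
    by (metis smooth_deriv.rep_eq zero_smooth.rep_eq)
  moreover have "smooth_apply (f - g) field_differentiable at x" for x
    using smooth_apply smooth_differentiable by blast
  ultimately have "(smooth_apply (f - g) has_field_derivative 0) (at x)" for x
    by (metis field_differentiable_derivI)
  then have "smooth_apply (f - g) x = smooth_apply (f - g) 0" for x
    using DERIV_isconst_all by blast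
  then have "smooth_apply f x = smooth_apply g x" for x
    using assms(2) by (simp add: minus_smooth.rep_eq)
  then show ?thesis by (simp add: smooth_apply_inject[symmetric] fun_eq_iff)
qed

section \<open>Reading off coefficients by testing on powers of x - t\<close>

lemma smooth_apply_sum: "smooth_apply (\<Sum>i\<in>S. f i) x = (\<Sum>i\<in>S. smooth_apply (f i) x)"
  by (induction S rule: infinite_finite_induct) (auto simp: zero_smooth.rep_eq plus_smooth.rep_eq)

lemma smooth_apply_prod: "smooth_apply (\<Prod>i\<in>S. f i) x = (\<Prod>i\<in>S. smooth_apply (f i) x)"
  by (induction S rule: infinite_finite_induct) (auto simp: one_smooth.rep_eq times_smooth.rep_eq)

lemma smooth_deriv_power:
  assumes "smooth_deriv y = 1"
  shows "smooth_deriv (y ^ Suc m) = real (Suc m) *\<^sub>R y ^ m"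
proof (induction m)
  case (Suc m)
  have "smooth_deriv (y * y ^ Suc m) = y * (real (Suc m) *\<^sub>R y ^ m) + 1 * y ^ Suc m"
    by (simp only: smooth_deriv_mult Suc assms)
  also have "\<dots> = real (Suc (Suc m)) *\<^sub>R y ^ Suc m"
    by (simp only: of_nat_Suc[of "Suc m"] scaleR_left_distrib scaleR_one mult_scaleR_right
        power_Suc mult_1_left add.commute)
  finally show ?case by (simp only: power_Suc)
qed (simp add: assms)

text \<open>Powers of x - t are dual, up to factorials, to the derivatives at t: too few derivatives
  leave a factor x - t, too many give 0.\<close>

lemma smooth_deriv_pow_shift:
  "smooth_apply ((smooth_deriv ^^ j) ((smooth_coord - t *\<^sub>R 1) ^ m)) t =
     (if j = m then fact m else 0)"
proof -
  let ?x = "smooth_coord - t *\<^sub>R 1"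
  have lin: "linear (smooth_deriv ^^ j)" for j
    by (induction j)
      (use linear_compose[OF _ linear_smooth_deriv] in \<open>auto simp: linear_ident o_def\<close>)
  have "smooth_deriv ?x = 1"
    by (simp add: linear_diff[OF linear_smooth_deriv] smooth_deriv_scaleR)
  then have D: "smooth_deriv (?x ^ Suc m) = real (Suc m) *\<^sub>R ?x ^ m" for m
    by (rule smooth_deriv_power)
  show ?thesis
  proof (induction j arbitrary: m)
    case 0
    then show ?case
      by (cases m) (simp_all add: one_smooth.rep_eq minus_smooth.rep_eq times_smooth.rep_eq
          scaleR_smooth.rep_eq smooth_coord.rep_eq)
  next
    case (Suc j)
    show ?case
    proof (cases m)
      case 0
      have "(smooth_deriv ^^ Suc j) 1 = 0"
        by (simp only: funpow_Suc_right comp_apply smooth_deriv_one linear_0[OF lin])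
      then show ?thesis using 0 by (simp add: zero_smooth.rep_eq)
    next
      case (Suc l)
      have "(smooth_deriv ^^ Suc j) (?x ^ m) = real m *\<^sub>R (smooth_deriv ^^ j) (?x ^ l)"
        \<comment> \<open>The innermost derivative is peeled off, so that it lowers the exponent;
          hence the induction is over arbitrary \<open>m\<close>.\<close>
        by (simp only: funpow_Suc_right comp_apply D Suc linear_scale[OF lin])
      then show ?thesis using Suc Suc.IH[of l] by (simp add: scaleR_smooth.rep_eq)
    qed
  qed
qed

text \<open>One index where \<alpha> and \<beta> differ already makes a factor of the product
  vanish.\<close>

lemma tuple_deriv_pow_shift:
  "smooth_apply (tuple_deriv \<alpha> (\<lambda>i. (smooth_coord - t *\<^sub>R 1) ^ \<beta> i)) t =
     (if \<alpha> = \<beta> then \<Prod>i\<in>UNIV. fact (\<beta> i) else 0)"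
proof (cases "\<alpha> = \<beta>")
  case True
  then show ?thesis by (simp add: tuple_deriv_def smooth_apply_prod smooth_deriv_pow_shift)
next
  case False
  then obtain i where "\<alpha> i \<noteq> \<beta> i" by auto
  then show ?thesis
    using False by (auto simp: tuple_deriv_def smooth_apply_prod smooth_deriv_pow_shift)
qed

lemma sum_monomial_op_apply: "(\<Sum>\<alpha>\<in>S. monomial_op \<alpha> (a \<alpha>)) F = (\<Sum>\<alpha>\<in>S. a \<alpha> * tuple_deriv \<alpha> F)"
  by (induction S rule: infinite_finite_induct) (auto simp: monomial_op_def)

lemma smooth_apply_sum_monomial_op:
  assumes "finite S"
  shows "smooth_apply ((\<Sum>\<alpha>\<in>S. monomial_op \<alpha> (a \<alpha>)) (\<lambda>i. (smooth_coord - t *\<^sub>R 1) ^ \<beta> i)) t =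
    (if \<beta> \<in> S then smooth_apply (a \<beta>) t * (\<Prod>i\<in>UNIV. fact (\<beta> i)) else 0)"
  using assms
  by (simp add: sum_monomial_op_apply smooth_apply_sum times_smooth.rep_eq tuple_deriv_pow_shift
      if_distrib cong: if_cong)

text \<open>Testing on powers of x - t determines the \<beta>-coefficient at t; letting t vary
  determines it as a function.\<close>

lemma monomial_op_coeff_unique:
  assumes "finite S" "(\<Sum>\<alpha>\<in>S. monomial_op \<alpha> (a \<alpha>)) = (\<Sum>\<alpha>\<in>S. monomial_op \<alpha> (b \<alpha>))" "\<beta> \<in> S"
  shows "a \<beta> = b \<beta>"
proof -
  have "smooth_apply (a \<beta>) t = smooth_apply (b \<beta>) t" for t
    using smooth_apply_sum_monomial_op[OF assms(1), of a t \<beta>]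
      smooth_apply_sum_monomial_op[OF assms(1), of b t \<beta>] assms(2,3)
    by simp
  then show ?thesis by (simp add: smooth_apply_inject[symmetric] fun_eq_iff)
qed

text \<open>Both families are padded by zero coefficients, so that two operators can be compared
  index by index.\<close>

lemma diff_ops_common_support:
  assumes "A \<in> diff_ops" "B \<in> diff_ops"
  obtains S a b where "finite S" "A = (\<Sum>\<alpha>\<in>S. monomial_op \<alpha> (a \<alpha>))" "B = (\<Sum>\<alpha>\<in>S. monomial_op \<alpha> (b \<alpha>))"
proof -
  obtain S a T b where A: "A = (\<Sum>\<alpha>\<in>S. monomial_op \<alpha> (a \<alpha>))" "finite S"
    and B: "B = (\<Sum>\<alpha>\<in>T. monomial_op \<alpha> (b \<alpha>))" "finite T"
    using assms unfolding diff_ops_altdef by blast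
  have 0: "monomial_op \<alpha> 0 = 0" for \<alpha> :: "'a \<Rightarrow> nat"
    by (rule linear_0[OF linear_monomial_op])
  have "A = (\<Sum>\<alpha>\<in>S \<union> T. monomial_op \<alpha> (if \<alpha> \<in> S then a \<alpha> else 0))"
    unfolding A(1) using A(2) B(2) by (intro sum.mono_neutral_cong_left) (auto simp: 0)
  moreover have "B = (\<Sum>\<alpha>\<in>S \<union> T. monomial_op \<alpha> (if \<alpha> \<in> T then b \<alpha> else 0))"
    unfolding B(1) using A(2) B(2) by (intro sum.mono_neutral_cong_left) (auto simp: 0)
  ultimately show ?thesis
    using that[of "S \<union> T" "\<lambda>\<alpha>. if \<alpha> \<in> S then a \<alpha> else 0" "\<lambda>\<alpha>. if \<alpha> \<in> T then b \<alpha> else 0"]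
      A(2) B(2) by simp
qed

section \<open>Cocycles of \<open>aff(1)\<close>\<close>

lemma vf_coeff_Aff1_one [simp]: "vf_coeff (Aff1 1) = 1"
  by (rule Aff1_inverse) (simp add: real_vector.span_base)

lemma vf_coeff_Aff1_coord [simp]: "vf_coeff (Aff1 smooth_coord) = smooth_coord"
  by (rule Aff1_inverse) (simp add: real_vector.span_base)

lemma aff1_bracket_basis: "aff1_bracket (Aff1 1) (Aff1 smooth_coord) = Aff1 1"
  by (simp add: vf_coeff_inject[symmetric] aff1_bracket.rep_eq vf_bracket_def)

lemma linear_eq_aff1:
  assumes "linear f" "linear g" "f (Aff1 1) = g (Aff1 1)"
    "f (Aff1 smooth_coord) = g (Aff1 smooth_coord)"
  shows "f = g"
proof
  fix X
  obtain a b where "vf_coeff X = a *\<^sub>R 1 + b *\<^sub>R smooth_coord"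
    using aff1_coeffE[OF vf_coeff] .
  then have "X = a *\<^sub>R Aff1 1 + b *\<^sub>R Aff1 smooth_coord"
    by (simp add: vf_coeff_inject[symmetric] plus_aff1.rep_eq scaleR_aff1.rep_eq)
  then show "f X = g X"
    using assms(3,4) by (simp add: linear_add[OF assms(1)] linear_add[OF assms(2)]
        linear_scale[OF assms(1)] linear_scale[OF assms(2)])
qed

text \<open>
  On the tuple of powers \<open>x\<^sup>\<beta>\<close> only the \<open>\<beta>\<close>-term survives at \<open>0\<close>, so this is the value at \<open>0\<close> of
  the \<open>\<beta>\<close>-coefficient of \<open>\<Omega> X\<^sub>x\<close>.
\<close>

definition cocycle_coeff ::
  "('n::finite \<Rightarrow> nat) \<Rightarrow> (aff1 \<Rightarrow> ('n \<Rightarrow> smooth) \<Rightarrow> smooth) \<Rightarrow> real" where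
  "cocycle_coeff \<beta> \<Omega> =
     smooth_apply (\<Omega> (Aff1 smooth_coord) (\<lambda>i. smooth_coord ^ \<beta> i)) 0 / (\<Prod>i\<in>UNIV. fact (\<beta> i))"

lemma linear_cocycle_coeff: "linear (cocycle_coeff \<beta>)"
  by (rule linearI)
    (auto simp: cocycle_coeff_def scaleR_fun_def plus_smooth.rep_eq scaleR_smooth.rep_eq
      add_divide_distrib)

lemma cocycle_coeff_sum_monomial_op:
  assumes "\<Omega> (Aff1 smooth_coord) = (\<Sum>\<alpha>\<in>S. monomial_op \<alpha> (q \<alpha>))" "finite S"
  shows "cocycle_coeff \<beta> \<Omega> = (if \<beta> \<in> S then smooth_apply (q \<beta>) 0 else 0)"
  using smooth_apply_sum_monomial_op[OF assms(2), of q 0 \<beta>]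
  by (simp add: cocycle_coeff_def assms(1))

text \<open>The coefficient h' is the divergence of the field, a constant function: 0 on
  \<open>X\<^sub>1\<close> and 1 on \<open>X\<^sub>x\<close>.\<close>

definition basic_cocycle :: "('n::finite \<Rightarrow> nat) \<Rightarrow> aff1 \<Rightarrow> ('n \<Rightarrow> smooth) \<Rightarrow> smooth" where
  "basic_cocycle \<beta> X = monomial_op \<beta> (smooth_deriv (vf_coeff X))"

text \<open>Both sides of the cocycle identity vanish: the coefficients have weight 0, where fields
  kill constants, and brackets in aff(1) have constant coefficients, hence divergence 0.\<close>

lemma basic_cocycle_in_cocycles:
  fixes lam :: "'n::finite \<Rightarrow> real"
  assumes "\<mu> - (\<Sum>i\<in>UNIV. lam i) = real (sum \<beta> UNIV)"
  shows "basic_cocycle \<beta> \<in> cocycles lam \<mu>"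
proof -
  have "linear (basic_cocycle \<beta>)"
    by (rule linearI)
      (simp_all add: basic_cocycle_def plus_aff1.rep_eq scaleR_aff1.rep_eq smooth_deriv_add
        smooth_deriv_scaleR linear_add[OF linear_monomial_op] linear_scale[OF linear_monomial_op])
  moreover have "range (basic_cocycle \<beta>) \<subseteq> diff_ops"
    using sum_monomial_op_in_diff_ops[of "{\<beta>}"] by (auto simp: basic_cocycle_def)
  moreover have "op_action lam \<mu> (vf_coeff X) (basic_cocycle \<beta> Y) = 0" for X Y
    using assms
    by (simp add: basic_cocycle_def op_action_monomial lie_density_def linear_0[OF linear_monomial_op])
  moreover have "smooth_deriv (vf_bracket (vf_coeff X) (vf_coeff Y)) = 0" for X Y
    by (simp add: vf_bracket_def smooth_deriv_mult linear_diff[OF linear_smooth_deriv])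
  then have "basic_cocycle \<beta> (aff1_bracket X Y) = 0" for X Y
    by (simp add: basic_cocycle_def aff1_bracket.rep_eq linear_0[OF linear_monomial_op])
  ultimately show ?thesis by (simp add: cocycles_def)
qed

lemma cocycle_coeff_basic_cocycle: "cocycle_coeff \<gamma> (basic_cocycle \<beta>) = of_bool (\<gamma> = \<beta>)"
  using cocycle_coeff_sum_monomial_op[of "basic_cocycle \<beta>" "\<lambda>_. 1" "{\<beta>}" \<gamma>]
  by (simp add: basic_cocycle_def one_smooth.rep_eq)

text \<open>In weight 0 the field \<open>X\<^sub>x\<close> sends the coefficient a to x a', which
  vanishes at 0.\<close>

lemma cocycle_coeff_coboundary:
  fixes lam :: "'n::finite \<Rightarrow> real"
  assumes "\<mu> - (\<Sum>i\<in>UNIV. lam i) = real (sum \<beta> UNIV)" "\<Omega> \<in> coboundaries lam \<mu>"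
  shows "cocycle_coeff \<beta> \<Omega> = 0"
proof -
  obtain S a where S: "finite S"
    and \<Omega>: "\<Omega> = (\<lambda>X. op_action lam \<mu> (vf_coeff X) (\<Sum>\<alpha>\<in>S. monomial_op \<alpha> (a \<alpha>)))"
    using assms(2) by (auto simp: coboundaries_def diff_ops_altdef)
  let ?q = "\<lambda>\<alpha>. lie_density (\<mu> - (\<Sum>i\<in>UNIV. lam i) - real (\<Sum>i\<in>UNIV. \<alpha> i)) smooth_coord (a \<alpha>)"
  have "\<Omega> (Aff1 smooth_coord) = (\<Sum>\<alpha>\<in>S. monomial_op \<alpha> (?q \<alpha>))"
    unfolding \<Omega> op_action_sum by simp
  then have "cocycle_coeff \<beta> \<Omega> = (if \<beta> \<in> S then smooth_apply (?q \<beta>) 0 else 0)"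
    using S by (rule cocycle_coeff_sum_monomial_op)
  then show ?thesis
    using assms(1)
    by (simp add: lie_density_def times_smooth.rep_eq smooth_coord.rep_eq)
qed

section \<open>Solving the coboundary equation\<close>

lemma coefficient_cobounding:
  assumes cocycle: "p = smooth_deriv q - (smooth_coord * smooth_deriv p + \<nu> *\<^sub>R p)"
    and "\<nu> = 0 \<Longrightarrow> smooth_apply q 0 = 0"
  obtains b where "lie_density \<nu> 1 b = p" "lie_density \<nu> smooth_coord b = q"
proof -
  \<comment> \<open>for \<open>\<nu> = 0\<close> the prescribed value is the junk \<open>0\<close>, which is harmless\<close>
  obtain b where b: "smooth_deriv b = p" "smooth_apply b 0 = smooth_apply q 0 / \<nu>"
    using smooth_antiderivative .
  \<comment> \<open>As b' = p, the left side is p + x p' + \<nu> p, which the cocycle identity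
    equates with q'.\<close>
  have "smooth_deriv (lie_density \<nu> smooth_coord b) = smooth_deriv q"
    using cocycle
    by (simp add: lie_density_def smooth_deriv_add smooth_deriv_mult smooth_deriv_scaleR b(1)
        algebra_simps)
  moreover have "smooth_apply (lie_density \<nu> smooth_coord b) 0 = smooth_apply q 0"
    using assms(2) b(2)
    by (auto simp: lie_density_def plus_smooth.rep_eq times_smooth.rep_eq scaleR_smooth.rep_eq
        smooth_coord.rep_eq)
  ultimately have "lie_density \<nu> smooth_coord b = q" by (rule smooth_eqI_deriv)
  moreover have "lie_density \<nu> 1 b = p" by (simp add: lie_density_def b(1))
  ultimately show ?thesis using that by blast
qed

text \<open>The action preserves each multi-index, so the equation is solved separately for each
  \<alpha> in the finite common support, and the solutions are summed to one operator.\<close>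

lemma coboundary_if_coeffs_zero:
  fixes lam :: "'n::finite \<Rightarrow> real"
  assumes \<mu>: "\<mu> - (\<Sum>i\<in>UNIV. lam i) = real k" and \<Omega>: "\<Omega> \<in> cocycles lam \<mu>"
    and zero: "\<And>\<beta>. sum \<beta> UNIV = k \<Longrightarrow> cocycle_coeff \<beta> \<Omega> = 0"
  shows "\<Omega> \<in> coboundaries lam \<mu>"
proof -
  let ?X1 = "Aff1 1" and ?Xx = "Aff1 smooth_coord"
  define \<nu> where "\<nu> \<alpha> = real k - real (sum \<alpha> UNIV)" for \<alpha> :: "'n \<Rightarrow> nat"
  have action: "op_action lam \<mu> (vf_coeff X) (\<Sum>\<alpha>\<in>S. monomial_op \<alpha> (a \<alpha>)) =
      (\<Sum>\<alpha>\<in>S. monomial_op \<alpha> (lie_density (\<nu> \<alpha>) (vf_coeff X) (a \<alpha>)))" for X S a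
    unfolding op_action_sum \<mu> \<nu>_def ..
  have "\<Omega> ?X1 \<in> diff_ops" "\<Omega> ?Xx \<in> diff_ops"
    using \<Omega> by (auto simp: cocycles_def)
  then obtain S p q where S: "finite S" and p: "\<Omega> ?X1 = (\<Sum>\<alpha>\<in>S. monomial_op \<alpha> (p \<alpha>))"
    and q: "\<Omega> ?Xx = (\<Sum>\<alpha>\<in>S. monomial_op \<alpha> (q \<alpha>))"
    by (rule diff_ops_common_support)
  have "\<Omega> (aff1_bracket ?X1 ?Xx) =
      op_action lam \<mu> (vf_coeff ?X1) (\<Omega> ?Xx) - op_action lam \<mu> (vf_coeff ?Xx) (\<Omega> ?X1)"
    using \<Omega> unfolding cocycles_def by blast
  \<comment> \<open>Since \<open>X\<^sub>1\<close> is its own bracket with \<open>X\<^sub>x\<close>,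
    the left side is \<open>\<Omega> X\<^sub>1\<close> itself; uniqueness of coefficients then
    splits the identity by \<alpha>.\<close>
  then have "(\<Sum>\<alpha>\<in>S. monomial_op \<alpha> (p \<alpha>)) = (\<Sum>\<alpha>\<in>S. monomial_op \<alpha>
      (lie_density (\<nu> \<alpha>) 1 (q \<alpha>) - lie_density (\<nu> \<alpha>) smooth_coord (p \<alpha>)))"
    unfolding aff1_bracket_basis p q action
    by (simp add: linear_diff[OF linear_monomial_op] sum_subtractf)
  from monomial_op_coeff_unique[OF S this]
  have cocycle: "p \<alpha> = smooth_deriv (q \<alpha>) - (smooth_coord * smooth_deriv (p \<alpha>) + \<nu> \<alpha> *\<^sub>R p \<alpha>)"
    if "\<alpha> \<in> S" for \<alpha>
    using that by (simp add: lie_density_def)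
  have "\<exists>b. lie_density (\<nu> \<alpha>) 1 b = p \<alpha> \<and> lie_density (\<nu> \<alpha>) smooth_coord b = q \<alpha>"
    if "\<alpha> \<in> S" for \<alpha>
  proof -
    \<comment> \<open>Weight 0 means order k, exactly the case covered by
      \<open>zero\<close>.\<close>
    have "smooth_apply (q \<alpha>) 0 = 0" if "\<nu> \<alpha> = 0"
    proof -
      have "sum \<alpha> UNIV = k" using that unfolding \<nu>_def by linarith
      then show ?thesis
        using zero[of \<alpha>] \<open>\<alpha> \<in> S\<close> cocycle_coeff_sum_monomial_op[of \<Omega> q S \<alpha>, OF q S] by simp
    qed
    with cocycle[OF that] show ?thesis
      by (rule coefficient_cobounding) auto
  qed
  then obtain b where b: "\<And>\<alpha>. \<alpha> \<in> S \<Longrightarrow> lie_density (\<nu> \<alpha>) 1 (b \<alpha>) = p \<alpha>"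
    "\<And>\<alpha>. \<alpha> \<in> S \<Longrightarrow> lie_density (\<nu> \<alpha>) smooth_coord (b \<alpha>) = q \<alpha>"
    by metis
  let ?d = "\<lambda>X. op_action lam \<mu> (vf_coeff X) (\<Sum>\<alpha>\<in>S. monomial_op \<alpha> (b \<alpha>))"
  have d: "?d \<in> coboundaries lam \<mu>"
    using sum_monomial_op_in_diff_ops[OF S] by (auto simp: coboundaries_def)
  \<comment> \<open>Both maps are cocycles, hence linear, so agreement on the two basis fields
    suffices.\<close>
  then have "linear ?d" "linear \<Omega>"
    using coboundaries_subset_cocycles[of lam \<mu>] \<Omega> by (auto simp: cocycles_def)
  moreover have "\<Omega> ?X1 = ?d ?X1" "\<Omega> ?Xx = ?d ?Xx"
    unfolding action p q by (auto simp: b)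
  ultimately have "\<Omega> = ?d" by (intro linear_eq_aff1)
  with d show ?thesis by simp
qed

theorem theorem3p3:
  fixes lam :: "'n::finite \<Rightarrow> real" and \<mu> :: real and k :: nat
  assumes "\<mu> - (\<Sum>i\<in>UNIV. lam i) = real k"
  shows "vectorspace.fin_dim class_ring (H1_diff lam \<mu>) \<and>
         vectorspace.dim class_ring (H1_diff lam \<mu>) = (CARD('n) + k - 1) choose k"
proof -
  let ?I = "{\<beta> :: 'n \<Rightarrow> nat. sum \<beta> UNIV = k}"
  have kernel: "coboundaries lam \<mu> = {\<Omega> \<in> cocycles lam \<mu>. \<forall>\<beta>\<in>?I. cocycle_coeff \<beta> \<Omega> = 0}"
    using coboundary_if_coeffs_zero[OF assms] cocycle_coeff_coboundary[of \<mu> lam] assms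
      coboundaries_subset_cocycles[of lam \<mu>]
    by auto
  have basic: "basic_cocycle \<beta> \<in> cocycles lam \<mu>" if "\<beta> \<in> ?I" for \<beta>
    using that assms by (intro basic_cocycle_in_cocycles) auto
  \<comment> \<open>The functionals \<open>cocycle_coeff \<beta>\<close> and the cocycles
    \<open>basic_cocycle \<beta>\<close> with \<beta> of order k form the dual system.\<close>
  have "vectorspace.fin_dim class_ring (H1_diff lam \<mu>) \<and>
      vectorspace.dim class_ring (H1_diff lam \<mu>) = card ?I"
    unfolding H1_diff_def
    by (rule dim_quotient_space[OF subspace_cocycles subspace_coboundaries finite_multi_indices _
          kernel basic])
      (simp_all add: linear_cocycle_coeff cocycle_coeff_basic_cocycle)
  then show ?thesis by (simp only: card_multi_indices)
qed

end
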